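(* Let $X,Y$ be LCTV spaces, $\phi\colon X\times Y\to\overline{\mathbb R}$ a function, $F\colon X\rightrightarrows Y$ a set-valued mapping, and let $\mu(x):=\inf\{\phi(x,y)\mid y\in F(x)\}$ for $x\in X$. Put $\mathcal V_p:=\inf\{\phi(0,y)\mid y\in F(0)\}$ and $\mathcal V_d^1:=\sup\{-\mu^*(x^* )\mid x^*\in X^*\}$, and let $x_0^*\in X^*$. Then $x_0^*\in\partial\mu(0)$ if and only if $x_0^*$ is a solution to the problem $$\text{maximize }-\mu^*(x^* )\ \text{ subject to }\ x^*\in X^*$$ and $\mathcal V_p=\mathcal V_d^1\in\mathbb R$.
   Context: LCTV space means real locally convex Hausdorff topological vector space; $X^*$ is the topological dual and $\langle x^*,x\rangle=x^*(x)$. $\overline{\mathbb R}=\mathbb R\cup\{-\infty\}\cup\{\infty\}$ and $\inf\emptyset=\infty$. $\mu^*(x^* )=\sup\{\langle x^*,x\rangle-\mu(x)\mid x\in X\}$ is the Fenchel conjugate. $\partial\mu(0)=\{x^*\in X^*\mid\langle x^*,x\rangle\le\mu(x)-\mu(0)\ \forall x\in X\}$ if $\mu(0)\in\mathbb R$, and $\partial\mu(0)=\emptyset$ otherwise (no convexity of $\mu$ is assumed). A solution of the maximization problem is an element $x_0^*$ with $-\mu^*(x_0^* )=\mathcal V_d^1$. *)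

theory Defs
  imports "HOL-Analysis.Analysis"
begin

text \<open>Real locally convex Hausdorff topological vector spaces.  Addition and negation are
  continuous by \<open>topological_ab_group_add\<close>, and \<open>t2_space\<close> is the Hausdorff property.
  In \<open>locally_convex_unfolded\<close> the predicate \<^const>\<open>convex\<close> is written out because its sort
  constraint is not accepted inside a class specification.\<close>

class lctv_space = real_vector + topological_ab_group_add + t2_space +
  assumes tendsto_scaleR_Pair:
      "LIM p (nhds c \<times>\<^sub>F nhds x). fst p *\<^sub>R snd p :> nhds (c *\<^sub>R x)"
    and locally_convex_unfolded:
      "open U \<Longrightarrow> 0 \<in> U \<Longrightarrow> \<exists>V. open V \<and>
        (\<forall>x\<in>V. \<forall>y\<in>V. \<forall>u\<ge>0. \<forall>v\<ge>0. u + v = 1 \<longrightarrow> u *\<^sub>R x + v *\<^sub>R y \<in> V) \<and>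
        0 \<in> V \<and> V \<subseteq> U"

lemma locally_convex:
  fixes U :: "'a::lctv_space set"
  assumes "open U" "0 \<in> U"
  shows "\<exists>V. open V \<and> convex V \<and> 0 \<in> V \<and> V \<subseteq> U"
  using locally_convex_unfolded[OF assms] by (simp add: convex_def)

instance real_normed_vector \<subseteq> lctv_space
proof
  fix c :: real and x :: 'a
  show "LIM p (nhds c \<times>\<^sub>F nhds x). fst p *\<^sub>R snd p :> nhds (c *\<^sub>R x)"
    by (intro tendsto_scaleR filterlim_fst filterlim_snd)
next
  fix U :: "'a set"
  assume "open U" "0 \<in> U"
  then obtain e where "e > 0" "ball 0 e \<subseteq> U"
    by (auto simp: open_contains_ball)
  then have "\<exists>V. open V \<and> convex V \<and> 0 \<in> V \<and> V \<subseteq> U"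
    by (intro exI[of _ "ball 0 e"]) auto
  then show "\<exists>V. open V \<and>
      (\<forall>x\<in>V. \<forall>y\<in>V. \<forall>u\<ge>0. \<forall>v\<ge>0. u + v = 1 \<longrightarrow> u *\<^sub>R x + v *\<^sub>R y \<in> V) \<and>
      0 \<in> V \<and> V \<subseteq> U"
    by (simp add: convex_def)
qed

definition topological_dual :: "('a::lctv_space \<Rightarrow> real) set" where
  "topological_dual = {f. linear f \<and> continuous_on UNIV f}"

text \<open>The infimum over the empty set is \<open>\<infinity>\<close>, the top element of \<^typ>\<open>ereal\<close>.\<close>

definition optimal_value :: "('a \<times> 'b \<Rightarrow> ereal) \<Rightarrow> ('a \<Rightarrow> 'b set) \<Rightarrow> 'a \<Rightarrow> ereal" where
  "optimal_value \<phi> F x = (INF y\<in>F x. \<phi> (x, y))"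

definition fenchel_conjugate :: "('a::lctv_space \<Rightarrow> ereal) \<Rightarrow> ('a \<Rightarrow> real) \<Rightarrow> ereal" where
  "fenchel_conjugate \<mu> xs = (SUP x. ereal (xs x) - \<mu> x)"

definition subdifferential_at_0 :: "('a::lctv_space \<Rightarrow> ereal) \<Rightarrow> ('a \<Rightarrow> real) set" where
  "subdifferential_at_0 \<mu> =
    (if \<bar>\<mu> 0\<bar> \<noteq> \<infinity> then {xs \<in> topological_dual. \<forall>x. ereal (xs x) \<le> \<mu> x - \<mu> 0} else {})"

definition primal_value ::
    "('a::lctv_space \<times> 'b::lctv_space \<Rightarrow> ereal) \<Rightarrow> ('a \<Rightarrow> 'b set) \<Rightarrow> ereal" where
  "primal_value \<phi> F = (INF y\<in>F 0. \<phi> (0, y))"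

definition dual_value :: "('a::lctv_space \<Rightarrow> ereal) \<Rightarrow> ereal" where
  "dual_value \<mu> = (SUP xs\<in>topological_dual. - fenchel_conjugate \<mu> xs)"

definition solves_dual :: "('a::lctv_space \<Rightarrow> ereal) \<Rightarrow> ('a \<Rightarrow> real) \<Rightarrow> bool" where
  "solves_dual \<mu> xs \<longleftrightarrow>
    xs \<in> topological_dual \<and> - fenchel_conjugate \<mu> xs = dual_value \<mu>"

end

theory Submission
  imports Defs
begin

text \<open>Testing the supremum in \<open>\<mu>\<^sup>*(x\<^sup>*)\<close> at the origin gives weak duality
  \<open>-\<mu>\<^sup>*(x\<^sup>*) \<le> \<mu>(0)\<close>, and \<open>\<mu>(0)\<close> is the primal value. When \<open>\<mu>(0)\<close> is finite, the subgradient
  inequality at \<open>0\<close> says exactly that \<open>\<mu>(0)\<close> is a lower bound of \<open>\<mu> - x\<^sup>*\<close>, whose infimum is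
  \<open>-\<mu>\<^sup>*(x\<^sup>*)\<close>; so it is the reverse of weak duality at \<open>x\<^sup>*\<close> (lemma
  \<open>subdifferential_at_0_iff_le\<close>). Hence \<open>x\<^sup>*\<close> is a subgradient iff \<open>-\<mu>\<^sup>*(x\<^sup>*)\<close> attains the finite
  common bound \<open>\<mu>(0)\<close> of all dual values, which is to say that \<open>x\<^sup>*\<close> is dual optimal without
  duality gap.\<close>

lemma primal_value_eq_optimal_value: "primal_value \<phi> F = optimal_value \<phi> F 0"
  by (simp add: primal_value_def optimal_value_def)

lemma weak_duality:
  assumes "xs \<in> topological_dual"
  shows "- fenchel_conjugate \<mu> xs \<le> \<mu> 0"
proof -
  have "xs 0 = 0"
    using assms by (simp add: topological_dual_def linear_0)
  then have "- \<mu> 0 \<le> fenchel_conjugate \<mu> xs"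
    unfolding fenchel_conjugate_def by (intro SUP_upper2[of 0]) (auto simp: zero_ereal_def[symmetric])
  then show ?thesis
    by (simp add: ereal_uminus_le_reorder)
qed

lemma dual_value_le: "dual_value \<mu> \<le> \<mu> 0"
  unfolding dual_value_def by (intro SUP_least weak_duality)

text \<open>As \<open>a\<close> and \<open>m\<close> are real, no difference is of the form \<open>\<infinity> - \<infinity>\<close>, so \<open>t\<close> may be infinite:
  both sides hold for \<open>t = \<infinity>\<close> and fail for \<open>t = -\<infinity>\<close>.\<close>

lemma ereal_le_diff_swap:
  fixes t :: ereal
  shows "ereal a \<le> t - ereal m \<longleftrightarrow> ereal a - t \<le> - ereal m"
  by (cases t) auto

text \<open>Together with weak duality this is the equality case of the Fenchel--Young inequality at
  the origin.\<close>

lemma subdifferential_at_0_iff_le: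
  assumes "xs \<in> topological_dual"
  shows "xs \<in> subdifferential_at_0 \<mu> \<longleftrightarrow> \<bar>\<mu> 0\<bar> \<noteq> \<infinity> \<and> \<mu> 0 \<le> - fenchel_conjugate \<mu> xs"
proof (cases "\<bar>\<mu> 0\<bar> = \<infinity>")
  case True
  then show ?thesis
    by (simp add: subdifferential_at_0_def)
next
  case False
  then obtain m where m: "\<mu> 0 = ereal m"
    by auto
  have "(\<forall>x. ereal (xs x) \<le> \<mu> x - \<mu> 0) \<longleftrightarrow> fenchel_conjugate \<mu> xs \<le> - \<mu> 0"
    unfolding fenchel_conjugate_def SUP_le_iff m by (simp only: ereal_le_diff_swap ball_UNIV)
  also have "\<dots> \<longleftrightarrow> \<mu> 0 \<le> - fenchel_conjugate \<mu> xs"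
    by (metis ereal_minus_le_minus ereal_uminus_uminus)
  finally show ?thesis
    using False assms by (simp add: subdifferential_at_0_def)
qed

theorem theorem7p2:
  fixes \<phi> :: "'a::lctv_space \<times> 'b::lctv_space \<Rightarrow> ereal"
    and F :: "'a \<Rightarrow> 'b set"
    and \<mu> :: "'a \<Rightarrow> ereal"
    and x0 :: "'a \<Rightarrow> real"
  defines "\<mu> \<equiv> optimal_value \<phi> F"
  assumes "x0 \<in> topological_dual"
  shows "x0 \<in> subdifferential_at_0 \<mu> \<longleftrightarrow>
    solves_dual \<mu> x0 \<and> primal_value \<phi> F = dual_value \<mu> \<and> \<bar>dual_value \<mu>\<bar> \<noteq> \<infinity>"
proof -
  have primal: "primal_value \<phi> F = \<mu> 0"
    by (simp add: \<mu>_def primal_value_eq_optimal_value)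
  have lower: "- fenchel_conjugate \<mu> x0 \<le> dual_value \<mu>"
    unfolding dual_value_def using assms(2) by (rule SUP_upper)
  \<comment> \<open>If \<open>\<mu> 0\<close> is at most the dual objective at \<open>x0\<close>, then
    \<open>\<mu> 0 \<le> - fenchel_conjugate \<mu> x0 \<le> dual_value \<mu> \<le> \<mu> 0\<close> collapses to equalities.\<close>
  have "\<mu> 0 \<le> - fenchel_conjugate \<mu> x0 \<longleftrightarrow>
      - fenchel_conjugate \<mu> x0 = dual_value \<mu> \<and> \<mu> 0 = dual_value \<mu>"
    using lower dual_value_le[of \<mu>] by auto
  then show ?thesis
    using assms(2) by (auto simp: subdifferential_at_0_iff_le solves_dual_def primal)
qed

end
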